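(* Fix a receiver $i$ that tracks at most $K$ distinct peer identities during a finite decision episode and makes at most $n_{\max}$ probes per peer. Assume that for each peer $j$ the probe outcomes $X_{ij,r}$ are conditionally independent given their observation times $t_{ij,r}$ and satisfy $X_{ij,r}\in[0,1]$ with mean $\mu_{ij}(t_{ij,r})$. Let $\delta\in(0,1)$. Then, with probability at least $1-\delta$, $$\lvert\widehat\mu_{ij,n}-\bar\mu_{ij,n}\rvert\le r_n(\delta):=\sqrt{\frac{\log(2Kn_{\max}/\delta)}{2n}}$$ simultaneously for every tracked peer $j$ and every $1\le n\le n_{\max}$.
   Context: For peer $j$, probe $r$ is observed at time $t_{ij,r}$ with score $X_{ij,r}$; $\mu_{ij}(t)$ is the time-dependent mean compatibility. Define $\widehat\mu_{ij,n}=\frac1n\sum_{r=1}^nX_{ij,r}$ and $\bar\mu_{ij,n}=\frac1n\sum_{r=1}^n\mu_{ij}(t_{ij,r})$. *)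

theory Defs
  imports "HOL-Probability.Probability"
begin

(* The sub-sigma-algebra of M generated by the real random variables T r, r in R,
   taken jointly, i.e. by the random vector (T r), r in R. *)
definition generated_algebra ::
  "'a measure \<Rightarrow> 'i set \<Rightarrow> ('i \<Rightarrow> 'a \<Rightarrow> real) \<Rightarrow> 'a measure"
where
  "generated_algebra M R T =
     vimage_algebra (space M) (\<lambda>\<omega>. \<lambda>r\<in>R. T r \<omega>) (Pi\<^sub>M R (\<lambda>_. borel))"

(* The real random variables X r, r in R, are conditionally independent given the
   sub-sigma-algebra F of M.  As usual the product rule is an almost-sure identity
   between versions of conditional probabilities, here real_cond_exp of indicators. *)
definition cond_indep_vars ::
  "'a measure \<Rightarrow> 'a measure \<Rightarrow> 'i set \<Rightarrow> ('i \<Rightarrow> 'a \<Rightarrow> real) \<Rightarrow> bool"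
where
  "cond_indep_vars M F R X \<longleftrightarrow>
     (\<forall>r\<in>R. X r \<in> borel_measurable M) \<and>
     (\<forall>S A. S \<subseteq> R \<and> S \<noteq> {} \<and> finite S \<and> (\<forall>r\<in>S. A r \<in> sets borel) \<longrightarrow>
        (AE \<omega> in M.
           real_cond_exp M F (indicator (\<Inter>r\<in>S. X r -` A r \<inter> space M)) \<omega> =
           (\<Prod>r\<in>S. real_cond_exp M F (indicator (X r -` A r \<inter> space M)) \<omega>)))"

definition mu_hat :: "(nat \<Rightarrow> 'a \<Rightarrow> real) \<Rightarrow> nat \<Rightarrow> 'a \<Rightarrow> real" where
  "mu_hat X n \<omega> = (1 / real n) * (\<Sum>r = 1..n. X r \<omega>)"

definition mu_bar :: "(real \<Rightarrow> real) \<Rightarrow> (nat \<Rightarrow> 'a \<Rightarrow> real) \<Rightarrow> nat \<Rightarrow> 'a \<Rightarrow> real" where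
  "mu_bar \<mu> T n \<omega> = (1 / real n) * (\<Sum>r = 1..n. \<mu> (T r \<omega>))"

definition conf_radius :: "nat \<Rightarrow> nat \<Rightarrow> nat \<Rightarrow> real \<Rightarrow> real" where
  "conf_radius K nmax n \<delta> = sqrt (ln (2 * real K * real nmax / \<delta>) / (2 * real n))"

end

theory Submission
  imports Defs
begin

text \<open>Fix a peer and a sample size n, and let F be generated by all observation times of that
  peer. The conditional mean of each score given F is its time-dependent mean, so the difference of
  \<open>mu_hat\<close> and \<open>mu_bar\<close> is almost surely the average of n variables of the
  form X - E[X | F]. A conditional Hoeffding inequality (\<open>cond_Hoeffding_abs_ge\<close>)
  bounds the probability that this average reaches size eps by 2 exp(-2 n eps^2). The radius is the
  eps for which this equals delta / (K nmax). A union bound, valid under any dependence between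
  peers and sample sizes, then sums at most K nmax such terms.

  Conditional independence is given only as a product rule for events, and no conditional
  distributions are used. \<open>real_cond_exp_prod_cond_indep\<close> carries the rule over to
  [0,1]-valued variables by uniform approximation. In \<open>cond_Hoeffding_mgf\<close> each
  exponential is replaced by its chord over [0,1], which is affine in X, so that this product rule
  applies; Hoeffding's lemma bounds each resulting factor by exp(l^2 / 8). The tail bound follows by
  Chernoff's method.\<close>

section \<open>Threshold rounding and stability of conditional independence\<close>

text \<open>The sum counts the k with k \<le> m x, so it is the floor of m x: rounding x down to the
  grid of mesh 1/m costs at most 1/m.\<close>

lemma unit_interval_step_approx:
  fixes x :: real
  assumes "x \<in> {0..1}" "m > 0"
  shows "\<bar>(\<Sum>k = 1..m. indicator {real k / real m..} x) / real m - x\<bar> \<le> 1 / real m"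
proof -
  define N where "N = nat \<lfloor>real m * x\<rfloor>"
  have N: "real N \<le> real m * x" "real m * x < real N + 1"
    using assms by (auto simp: N_def)
  \<comment> \<open>Here x \<le> 1 matters: all N thresholds below x occur among the m available
    ones, so the count is not truncated.\<close>
  have "real N \<le> real m"
    using N(1) assms by (smt (verit) atLeastAtMost_iff mult_left_le of_nat_0_le_iff)
  have "indicator {real k / real m..} x = (if k \<in> {1..N} then 1 else 0 :: real)"
    if "k \<in> {1..m}" for k
  proof -
    have "real k / real m \<le> x \<longleftrightarrow> real k \<le> real m * x"
      using assms(2) by (simp add: field_simps)
    also have "\<dots> \<longleftrightarrow> k \<le> N"
      using N by linarith
    finally show ?thesis using that by (auto simp: indicator_def)
  qed
  then have "(\<Sum>k = 1..m. indicator {real k / real m..} x) =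
      (\<Sum>k = 1..m. if k \<in> {1..N} then 1 else 0 :: real)"
    by (intro sum.cong) auto
  also have "\<dots> = real N"
  proof -
    have "(\<Sum>k = 1..m. if k \<in> {1..N} then 1 else 0 :: real) = (\<Sum>k \<in> {1..m} \<inter> {1..N}. 1)"
      by (rule sum.inter_restrict[symmetric]) simp
    then show ?thesis
      using \<open>real N \<le> real m\<close> by (simp add: min_absorb2)
  qed
  finally have "(\<Sum>k = 1..m. indicator {real k / real m..} x) / real m - x = (real N - real m * x) / real m"
    using assms(2) by (simp add: diff_divide_distrib)
  then show ?thesis
    using N assms(2) by (simp add: abs_divide divide_right_mono)
qed

text \<open>A preimage under the composed variable is a preimage under \<open>X r\<close> of another
  Borel set, so the product rule is an instance of the given one. It serves for the affine maps
  below: chords and the reflection 1 - x.\<close>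

lemma cond_indep_vars_compose:
  fixes g :: "'i \<Rightarrow> real \<Rightarrow> real"
  assumes "cond_indep_vars M F R X" and g: "\<And>r. r \<in> R \<Longrightarrow> g r \<in> borel_measurable borel"
  shows "cond_indep_vars M F R (\<lambda>r \<omega>. g r (X r \<omega>))"
  unfolding cond_indep_vars_def
proof (intro conjI ballI allI impI)
  show "(\<lambda>\<omega>. g r (X r \<omega>)) \<in> borel_measurable M" if "r \<in> R" for r
    using assms that unfolding cond_indep_vars_def
    by (auto intro: measurable_compose)
next
  fix S :: "'i set" and A :: "'i \<Rightarrow> real set"
  assume S: "S \<subseteq> R \<and> S \<noteq> {} \<and> finite S \<and> (\<forall>r\<in>S. A r \<in> sets borel)"
  have "\<forall>r\<in>S. g r -` A r \<in> sets borel"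
    using S measurable_sets[OF g] by fastforce
  then have "AE \<omega> in M.
      real_cond_exp M F (indicator (\<Inter>r\<in>S. X r -` (g r -` A r) \<inter> space M)) \<omega> =
      (\<Prod>r\<in>S. real_cond_exp M F (indicator (X r -` (g r -` A r) \<inter> space M)) \<omega>)"
    using assms(1) S unfolding cond_indep_vars_def by (elim conjE allE[of _ S] allE[of _ "\<lambda>r. g r -` A r"]) auto
  then show "AE \<omega> in M.
      real_cond_exp M F (indicator (\<Inter>r\<in>S. (\<lambda>\<omega>. g r (X r \<omega>)) -` A r \<inter> space M)) \<omega> =
      (\<Prod>r\<in>S. real_cond_exp M F (indicator ((\<lambda>\<omega>. g r (X r \<omega>)) -` A r \<inter> space M)) \<omega>)"
    by (simp add: vimage_def)
qed

text \<open>Measurability of the joint vector turns its preimages into events of \<open>M\<close>;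
  this is what permits conditioning on the observation times.\<close>

lemma subalgebra_generated_algebra:
  assumes "\<And>r. r \<in> R \<Longrightarrow> T r \<in> borel_measurable M"
  shows "subalgebra M (generated_algebra M R T)"
proof -
  have "(\<lambda>\<omega>. \<lambda>r\<in>R. T r \<omega>) \<in> measurable M (Pi\<^sub>M R (\<lambda>_. borel))"
    using assms by (intro measurable_restrict) auto
  then have "sets (vimage_algebra (space M) (\<lambda>\<omega>. \<lambda>r\<in>R. T r \<omega>) (Pi\<^sub>M R (\<lambda>_. borel))) \<subseteq> sets M"
    unfolding measurable_iff_sets by (rule conjunct2)
  then show ?thesis
    by (simp add: subalgebra_def generated_algebra_def)
qed

section \<open>The product rule for conditional expectations\<close>

context sigma_finite_subalgebra
begin

lemma real_cond_exp_sum_finite: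
  fixes f :: "'i \<Rightarrow> 'a \<Rightarrow> real"
  assumes "\<And>i. i \<in> I \<Longrightarrow> integrable M (f i)"
  shows "AE x in M. real_cond_exp M F (\<lambda>x. \<Sum>i\<in>I. f i x) x = (\<Sum>i\<in>I. real_cond_exp M F (f i) x)"
proof -
  \<comment> \<open>Extending the family by zero outside \<open>I\<close> makes every index carry an
    integrable function, as \<open>real_cond_exp_sum\<close> asks.\<close>
  have "AE x in M. real_cond_exp M F (\<lambda>x. \<Sum>i\<in>I. (if i \<in> I then f i else (\<lambda>_. 0)) x) x =
      (\<Sum>i\<in>I. real_cond_exp M F (if i \<in> I then f i else (\<lambda>_. 0)) x)"
    by (rule real_cond_exp_sum) (use assms in auto)
  then show ?thesis by (simp cong: sum.cong)
qed

text \<open>Conditional expectation is monotone and fixes constants, hence contracts the sup norm.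
  Uniform approximation errors therefore survive conditioning.\<close>

lemma real_cond_exp_abs_diff_le:
  fixes f g :: "'a \<Rightarrow> real"
  assumes "integrable M f" "integrable M g" "AE x in M. \<bar>f x - g x\<bar> \<le> c"
  shows "AE x in M. \<bar>real_cond_exp M F f x - real_cond_exp M F g x\<bar> \<le> c"
proof -
  have i: "integrable M (\<lambda>x. f x - g x)" using assms by auto
  have "AE x in M. real_cond_exp M F (\<lambda>x. f x - g x) x \<ge> - c"
    by (rule real_cond_exp_ge_c[OF i], use assms(3) in eventually_elim) auto
  moreover have "AE x in M. real_cond_exp M F (\<lambda>x. f x - g x) x \<le> c"
    by (rule real_cond_exp_le_c[OF i], use assms(3) in eventually_elim) auto
  ultimately show ?thesis
    using real_cond_exp_diff[OF assms(1,2)] by eventually_elim auto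
qed

end

context finite_measure_subalgebra
begin

text \<open>Expand the product of sums over all choice functions from \<open>S\<close> to
  \<open>I\<close>. Each term is the indicator of one intersection, where the product rule for
  events applies; the same expansion read backwards refolds the result. There are finitely many
  choice functions, so the exceptional null sets still combine to a null set.\<close>

lemma real_cond_exp_prod_sum_indicator:
  assumes ci: "cond_indep_vars M F R X" and S: "S \<subseteq> R" "S \<noteq> {}" "finite S"
    and I: "finite I" and A: "\<And>k. k \<in> I \<Longrightarrow> A k \<in> sets borel"
  shows "AE \<omega> in M.
      real_cond_exp M F (\<lambda>\<omega>. \<Prod>r\<in>S. \<Sum>k\<in>I. indicator (X r -` A k \<inter> space M) \<omega>) \<omega> =
      (\<Prod>r\<in>S. real_cond_exp M F (\<lambda>\<omega>. \<Sum>k\<in>I. indicator (X r -` A k \<inter> space M) \<omega>) \<omega>)"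
proof -
  let ?B = "\<lambda>r k. X r -` A k \<inter> space M"
  let ?P = "PiE S (\<lambda>_. I)"
  have B: "?B r k \<in> sets M" if "r \<in> S" "k \<in> I" for r k
    using ci S that A unfolding cond_indep_vars_def by (auto intro!: measurable_sets)
  have BI: "(\<Inter>r\<in>S. ?B r (f r)) \<in> sets M" if "f \<in> ?P" for f
    using S that B by (intro sets.finite_INT) (auto simp: PiE_def)
  have fP: "finite ?P" using S I by (intro finite_PiE) auto
  have ind: "indicator (\<Inter>r\<in>S. ?B r (f r)) \<omega> = (\<Prod>r\<in>S. indicator (?B r (f r)) \<omega> :: real)" for f \<omega>
    using S(3) by (auto simp: indicator_def prod_zero_iff)
  have eq: "(\<lambda>\<omega>. \<Prod>r\<in>S. \<Sum>k\<in>I. indicator (?B r k) \<omega> :: real) =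
      (\<lambda>\<omega>. \<Sum>f\<in>?P. indicator (\<Inter>r\<in>S. ?B r (f r)) \<omega>)"
    unfolding ind by (intro ext prod_sum_PiE) (use S I in auto)
  have 1: "AE \<omega> in M. real_cond_exp M F (\<lambda>\<omega>. \<Sum>f\<in>?P. indicator (\<Inter>r\<in>S. ?B r (f r)) \<omega>) \<omega> =
      (\<Sum>f\<in>?P. real_cond_exp M F (indicator (\<Inter>r\<in>S. ?B r (f r))) \<omega>)"
    by (intro real_cond_exp_sum_finite integrable_real_indicator BI) (auto simp: emeasure_finite less_top[symmetric])
  have 2: "AE \<omega> in M. \<forall>f\<in>?P. real_cond_exp M F (indicator (\<Inter>r\<in>S. ?B r (f r))) \<omega> =
      (\<Prod>r\<in>S. real_cond_exp M F (indicator (?B r (f r))) \<omega>)"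
  proof (rule AE_finite_allI[OF fP])
    fix f assume "f \<in> ?P"
    then have "\<forall>r\<in>S. A (f r) \<in> sets borel" using A by (auto simp: PiE_def)
    then show "AE \<omega> in M. real_cond_exp M F (indicator (\<Inter>r\<in>S. ?B r (f r))) \<omega> =
      (\<Prod>r\<in>S. real_cond_exp M F (indicator (?B r (f r))) \<omega>)"
      using ci S unfolding cond_indep_vars_def
      by (elim conjE allE[of _ S] allE[of _ "\<lambda>r. A (f r)"]) auto
  qed
  have 3: "AE \<omega> in M. \<forall>r\<in>S. real_cond_exp M F (\<lambda>\<omega>. \<Sum>k\<in>I. indicator (?B r k) \<omega>) \<omega> =
      (\<Sum>k\<in>I. real_cond_exp M F (indicator (?B r k)) \<omega>)"
    by (intro AE_finite_allI[OF S(3)] real_cond_exp_sum_finite integrable_real_indicator B)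
       (auto simp: emeasure_finite less_top[symmetric])
  show ?thesis
    unfolding eq using 1 2 3
  proof eventually_elim
    case (elim \<omega>)
    have "(\<Prod>r\<in>S. \<Sum>k\<in>I. real_cond_exp M F (indicator (?B r k)) \<omega>) =
      (\<Sum>f\<in>?P. \<Prod>r\<in>S. real_cond_exp M F (indicator (?B r (f r))) \<omega>)"
      by (intro prod_sum_PiE) (use S I in auto)
    with elim show ?case by simp
  qed
qed

lemma integrable_unit_interval:
  fixes f :: "'a \<Rightarrow> real"
  assumes "f \<in> borel_measurable M" "AE \<omega> in M. f \<omega> \<in> {0..1}"
  shows "integrable M f"
  by (rule integrable_const_bound[of _ 1]) (use assms(1) in \<open>auto intro!: eventually_mono[OF assms(2)]\<close>)

lemma real_cond_exp_unit_interval: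
  fixes f :: "'a \<Rightarrow> real"
  assumes "f \<in> borel_measurable M" "AE \<omega> in M. f \<omega> \<in> {0..1}"
  shows "AE \<omega> in M. real_cond_exp M F f \<omega> \<in> {0..1}"
proof -
  note i = integrable_unit_interval[OF assms]
  have "AE \<omega> in M. real_cond_exp M F f \<omega> \<ge> 0" "AE \<omega> in M. real_cond_exp M F f \<omega> \<le> 1"
    using assms(2) by (auto intro!: real_cond_exp_ge_c[OF i] real_cond_exp_le_c[OF i] elim: eventually_mono)
  then show ?thesis by eventually_elim auto
qed

text \<open>Conditional independence only speaks about events. It is transferred to the variables
  by approximating each of them uniformly by a normalised sum of indicators.\<close>
proposition real_cond_exp_prod_cond_indep:
  assumes ci: "cond_indep_vars M F R X" and S: "S \<subseteq> R" "S \<noteq> {}" "finite S"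
    and bd: "\<And>r. r \<in> S \<Longrightarrow> AE \<omega> in M. X r \<omega> \<in> {0..1}"
  shows "AE \<omega> in M. real_cond_exp M F (\<lambda>\<omega>. \<Prod>r\<in>S. X r \<omega>) \<omega> =
      (\<Prod>r\<in>S. real_cond_exp M F (X r) \<omega>)"
proof -
  have X [measurable]: "X r \<in> borel_measurable M" if "r \<in> S" for r
    using ci S that unfolding cond_indep_vars_def by auto
  define A :: "nat \<Rightarrow> nat \<Rightarrow> real set" where "A m k = {real k / real m..}" for m k
  \<comment> \<open>Almost surely \<open>Y m r\<close> is \<open>X r\<close> rounded down to the
    grid of mesh 1/m. Only the unnormalised \<open>Z m r\<close> is literally a sum of indicators,
    so the factor 1/m is moved through the conditional expectation separately.\<close>
  define Z where "Z m r \<omega> = (\<Sum>k = 1..m. indicator (X r -` A m k \<inter> space M) \<omega> :: real)" for m r \<omega>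
  define Y where "Y m r \<omega> = Z m r \<omega> / real m" for m r \<omega>
  let ?E = "real_cond_exp M F"
  have B: "X r -` A m k \<inter> space M \<in> sets M" if "r \<in> S" for r m k
    using X[OF that] by (auto intro!: measurable_sets simp: A_def)
  have Zm [measurable]: "Z m r \<in> borel_measurable M" if "r \<in> S" for m r
    unfolding Z_def using B[OF that] by (intro borel_measurable_sum borel_measurable_indicator) auto
  then have Ym [measurable]: "Y m r \<in> borel_measurable M" if "r \<in> S" for m r
    unfolding Y_def using that by auto
  have Z0: "0 \<le> Z m r \<omega>" "Z m r \<omega> \<le> real m" for m r \<omega>
    using sum_bounded_above[of "{1..m}" "\<lambda>k. indicator (X r -` A m k \<inter> space M) \<omega> :: real" 1]
    by (auto simp: Z_def indicator_def intro!: sum_nonneg)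
  have Y1: "Y m r \<omega> \<in> {0..1}" for m r \<omega>
    using Z0[where m=m and r=r and \<omega>=\<omega>] by (auto simp: Y_def divide_le_eq_1)
  have iX: "integrable M (X r)" if "r \<in> S" for r
    using that bd by (intro integrable_unit_interval X) auto
  have iY: "integrable M (Y m r)" if "r \<in> S" for m r
    using that Y1 by (intro integrable_unit_interval Ym) auto
  have bdS: "AE \<omega> in M. \<forall>r\<in>S. X r \<omega> \<in> {0..1}"
    by (intro AE_finite_allI S bd)
  have iPX: "integrable M (\<lambda>\<omega>. \<Prod>r\<in>S. X r \<omega>)"
    by (rule integrable_unit_interval)
       (use bdS in \<open>auto elim!: eventually_mono intro!: prod_nonneg prod_le_1\<close>)
  have iPY: "integrable M (\<lambda>\<omega>. \<Prod>r\<in>S. Y m r \<omega>)" for m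
    by (rule integrable_unit_interval) (use Y1 in \<open>auto intro!: prod_nonneg prod_le_1\<close>)
  have iZ: "integrable M (Z m r)" if "r \<in> S" for m r
    unfolding Z_def using B[OF that]
    by (intro Bochner_Integration.integrable_sum integrable_real_indicator) (auto simp: emeasure_finite less_top[symmetric])
  have approx: "AE \<omega> in M. \<forall>r\<in>S. \<bar>Y m r \<omega> - X r \<omega>\<bar> \<le> 1 / real m" if "m > 0" for m
    using bdS AE_space
  proof eventually_elim
    case (elim \<omega>)
    have "Y m r \<omega> = (\<Sum>k = 1..m. indicator {real k / real m..} (X r \<omega>)) / real m" for r
      using elim by (auto simp: Y_def Z_def A_def indicator_def intro!: sum.cong)
    then show ?case
      using unit_interval_step_approx[OF _ that] elim by auto
  qed
  have cY: "AE \<omega> in M. ?E (\<lambda>\<omega>. \<Prod>r\<in>S. Y m r \<omega>) \<omega> = (\<Prod>r\<in>S. ?E (Y m r) \<omega>)" if "m > 0" for m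
  proof -
    have iPZ: "integrable M (\<lambda>\<omega>. \<Prod>r\<in>S. Z m r \<omega>)"
    proof -
      have "(\<lambda>\<omega>. \<Prod>r\<in>S. Z m r \<omega>) = (\<lambda>\<omega>. real m ^ card S * (\<Prod>r\<in>S. Y m r \<omega>))"
        using that by (simp add: Y_def prod_dividef)
      then show ?thesis using iPY by auto
    qed
    have "AE \<omega> in M. ?E (\<lambda>\<omega>. \<Prod>r\<in>S. Z m r \<omega>) \<omega> = (\<Prod>r\<in>S. ?E (\<lambda>\<omega>. Z m r \<omega>) \<omega>)"
      unfolding Z_def by (rule real_cond_exp_prod_sum_indicator[OF ci S]) (auto simp: A_def)
    moreover have "AE \<omega> in M. ?E (\<lambda>\<omega>. (\<Prod>r\<in>S. Z m r \<omega>) / real m ^ card S) \<omega> =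
        ?E (\<lambda>\<omega>. \<Prod>r\<in>S. Z m r \<omega>) \<omega> / real m ^ card S"
      by (rule real_cond_exp_cdiv[OF iPZ])
    moreover have "AE \<omega> in M. \<forall>r\<in>S. ?E (\<lambda>\<omega>. Z m r \<omega> / real m) \<omega> = ?E (Z m r) \<omega> / real m"
      by (intro AE_finite_allI S real_cond_exp_cdiv iZ)
    ultimately show ?thesis
      unfolding Y_def by eventually_elim (simp add: prod_dividef)
  qed
  \<comment> \<open>Triangle inequality through \<open>Y\<close>, where the product rule is exact.
    Products of numbers in [0,1] differ by at most the sum of the differences of their factors, so
    exchanging \<open>X\<close> for \<open>Y\<close> costs card S / m twice: once inside and once
    outside the conditional expectation.\<close>
  have dist: "AE \<omega> in M. \<bar>?E (\<lambda>\<omega>. \<Prod>r\<in>S. X r \<omega>) \<omega> - (\<Prod>r\<in>S. ?E (X r) \<omega>)\<bar> \<le> 2 * real (card S) / real m"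
    if m: "m > 0" for m
  proof -
    have "AE \<omega> in M. \<bar>(\<Prod>r\<in>S. Y m r \<omega>) - (\<Prod>r\<in>S. X r \<omega>)\<bar> \<le> real (card S) / real m"
      using approx[OF m] bdS
    proof eventually_elim
      case (elim \<omega>)
      have "\<bar>(\<Prod>r\<in>S. Y m r \<omega>) - (\<Prod>r\<in>S. X r \<omega>)\<bar> \<le> (\<Sum>r\<in>S. \<bar>Y m r \<omega> - X r \<omega>\<bar>)"
        using norm_prod_diff[of S "\<lambda>r. Y m r \<omega>" "\<lambda>r. X r \<omega>"] Y1 elim by auto
      also have "\<dots> \<le> (\<Sum>r\<in>S. 1 / real m)"
        using elim by (intro sum_mono) auto
      finally show ?case by simp
    qed
    then have "AE \<omega> in M. \<bar>?E (\<lambda>\<omega>. \<Prod>r\<in>S. Y m r \<omega>) \<omega> - ?E (\<lambda>\<omega>. \<Prod>r\<in>S. X r \<omega>) \<omega>\<bar> \<le> real (card S) / real m"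
      by (rule real_cond_exp_abs_diff_le[OF iPY iPX])
    moreover have "AE \<omega> in M. \<forall>r\<in>S. \<bar>?E (Y m r) \<omega> - ?E (X r) \<omega>\<bar> \<le> 1 / real m"
      by (intro AE_finite_allI S real_cond_exp_abs_diff_le iX iY)
         (use approx[OF m] in \<open>auto elim!: eventually_mono\<close>)
    moreover have "AE \<omega> in M. \<forall>r\<in>S. ?E (X r) \<omega> \<in> {0..1} \<and> ?E (Y m r) \<omega> \<in> {0..1}"
      using bd Y1 by (intro AE_finite_allI S AE_conjI real_cond_exp_unit_interval X Ym) auto
    ultimately show ?thesis
      using cY[OF m]
    proof eventually_elim
      case (elim \<omega>)
      have "\<bar>(\<Prod>r\<in>S. ?E (Y m r) \<omega>) - (\<Prod>r\<in>S. ?E (X r) \<omega>)\<bar> \<le> (\<Sum>r\<in>S. \<bar>?E (Y m r) \<omega> - ?E (X r) \<omega>\<bar>)"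
        using norm_prod_diff[of S "\<lambda>r. ?E (Y m r) \<omega>" "\<lambda>r. ?E (X r) \<omega>"] elim by auto
      also have "\<dots> \<le> (\<Sum>r\<in>S. 1 / real m)"
        using elim by (intro sum_mono) auto
      also have "\<dots> = real (card S) / real m" by simp
      finally show ?case using elim by auto
    qed
  qed
  \<comment> \<open>Countably many mesh sizes share one null set, so the limit can be taken
    pointwise; \<open>Suc n\<close> keeps the mesh number positive.\<close>
  have "AE \<omega> in M. \<forall>n. \<bar>?E (\<lambda>\<omega>. \<Prod>r\<in>S. X r \<omega>) \<omega> - (\<Prod>r\<in>S. ?E (X r) \<omega>)\<bar> \<le> 2 * real (card S) / real (Suc n)"
    using dist[OF zero_less_Suc] by (subst AE_all_countable) blast
  then show ?thesis
  proof eventually_elim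
    case (elim \<omega>)
    have "(\<lambda>n. 2 * real (card S) / real (Suc n)) \<longlonglongrightarrow> 0"
      by (rule LIMSEQ_Suc[OF lim_const_over_n])
    then have "\<bar>?E (\<lambda>\<omega>. \<Prod>r\<in>S. X r \<omega>) \<omega> - (\<Prod>r\<in>S. ?E (X r) \<omega>)\<bar> \<le> 0"
      by (rule LIMSEQ_le_const) (use elim in auto)
    then show ?case by simp
  qed
qed

section \<open>A conditional Hoeffding inequality\<close>

lemma exp_le_chord:
  fixes l x :: real
  assumes "l \<ge> 0" "x \<in> {0..1}"
  shows "exp (l * x) \<le> 1 - x + x * exp l"
  using convex_onD[OF convex_on_exp[OF assms(1)], of x 0 1] assms by simp

text \<open>For p \<le> 1 the left side is the moment generating function of a centred Bernoulli(p)
  variable, so this is Hoeffding's lemma in its extremal case; \<open>Hoeffdings_lemma_aux\<close>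
  is its logarithmic form.\<close>

lemma Hoeffding_chord_bound:
  fixes l p :: real
  assumes "l \<ge> 0" "p \<ge> 0"
  shows "exp (- l * p) * (1 - p + p * exp l) \<le> exp (l\<^sup>2 / 8)"
proof -
  have pos: "1 + p * (exp l - 1) > 0"
    using assms by (intro add_pos_nonneg mult_nonneg_nonneg) auto
  have "exp (- l * p) * (1 - p + p * exp l) = exp (- l * p + ln (1 + p * (exp l - 1)))"
    unfolding exp_add exp_ln[OF pos] by (simp add: algebra_simps)
  also have "\<dots> \<le> exp (l\<^sup>2 / 8)"
    using Hoeffdings_lemma_aux[OF assms] by simp
  finally show ?thesis .
qed

text \<open>Replacing each exponential by its chord over the unit interval makes the product
  multilinear, and the affine factors inherit conditional independence.\<close>
lemma cond_Hoeffding_mgf: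
  assumes "prob_space M"
    and ci: "cond_indep_vars M F R X" and S: "S \<subseteq> R" "S \<noteq> {}" "finite S"
    and bd: "\<And>r. r \<in> S \<Longrightarrow> AE \<omega> in M. X r \<omega> \<in> {0..1}"
    and l: "l \<ge> 0"
  shows "(\<integral>\<^sup>+\<omega>. exp (l * (\<Sum>r\<in>S. X r \<omega> - real_cond_exp M F (X r) \<omega>)) \<partial>M)
      \<le> ennreal (exp (real (card S) * l\<^sup>2 / 8))"
proof -
  interpret prob_space M by fact
  let ?E = "real_cond_exp M F"
  have X [measurable]: "X r \<in> borel_measurable M" if "r \<in> S" for r
    using ci S that unfolding cond_indep_vars_def by auto
  \<comment> \<open>The chord of exp(l x) divided by its maximum exp l on [0,1]. The division puts
    the values back into [0,1], as the product rule demands; \<open>W\<close> below restores the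
    factor.\<close>
  define Y where "Y r \<omega> = (1 - X r \<omega> + X r \<omega> * exp l) / exp l" for r \<omega>
  have Ym [measurable]: "Y r \<in> borel_measurable M" if "r \<in> S" for r
    unfolding Y_def using that by measurable
  have ciY: "cond_indep_vars M F R Y"
    unfolding Y_def by (rule cond_indep_vars_compose[OF ci]) measurable
  have el: "exp l \<ge> 1" using l by simp
  have unit: "(1 - x + x * exp l) / exp l \<in> {0..1}" if "x \<in> {0..1}" for x
  proof -
    have "(1 - x) * 1 \<le> (1 - x) * exp l" using that el by (intro mult_left_mono) auto
    moreover have "0 \<le> 1 - x + x * exp l" using that by auto
    ultimately show ?thesis by (simp add: divide_le_eq algebra_simps)
  qed
  have bdY: "AE \<omega> in M. Y r \<omega> \<in> {0..1}" if "r \<in> S" for r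
    using bd[OF that] unfolding Y_def by eventually_elim (rule unit)
  have bdS: "AE \<omega> in M. \<forall>r\<in>S. X r \<omega> \<in> {0..1}"
    by (intro AE_finite_allI S bd)
  have bdE: "AE \<omega> in M. \<forall>r\<in>S. ?E (X r) \<omega> \<in> {0..1}"
    by (intro AE_finite_allI S real_cond_exp_unit_interval bd X)
  have bdYS: "AE \<omega> in M. \<forall>r\<in>S. Y r \<omega> \<in> {0..1}"
    by (intro AE_finite_allI S bdY)
  \<comment> \<open>\<open>Y r\<close> is affine in \<open>X r\<close>, so its conditional
    expectation is the same affine function of that of \<open>X r\<close>. The exponential itself
    would not allow this.\<close>
  have EY: "AE \<omega> in M. \<forall>r\<in>S. ?E (Y r) \<omega> = (1 - ?E (X r) \<omega> + ?E (X r) \<omega> * exp l) / exp l"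
  proof (rule AE_finite_allI[OF S(3)])
    fix r assume r: "r \<in> S"
    have iX: "integrable M (X r)" using r bd by (intro integrable_unit_interval X) auto
    have Yr: "Y r = (\<lambda>\<omega>. 1 / exp l + (1 - 1 / exp l) * X r \<omega>)"
      by (auto simp: Y_def field_simps)
    have "AE \<omega> in M. ?E (\<lambda>\<omega>. 1 / exp l + (1 - 1 / exp l) * X r \<omega>) \<omega> =
        ?E (\<lambda>_. 1 / exp l) \<omega> + ?E (\<lambda>\<omega>. (1 - 1 / exp l) * X r \<omega>) \<omega>"
      by (rule real_cond_exp_add) (use iX in auto)
    moreover have "AE \<omega> in M. ?E (\<lambda>\<omega>. (1 - 1 / exp l) * X r \<omega>) \<omega> = (1 - 1 / exp l) * ?E (X r) \<omega>"
      by (rule real_cond_exp_cmult[OF iX])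
    moreover have "AE \<omega> in M. ?E (\<lambda>_. 1 / exp l) \<omega> = 1 / exp l"
      by (rule real_cond_exp_F_meas) auto
    ultimately show "AE \<omega> in M. ?E (Y r) \<omega> = (1 - ?E (X r) \<omega> + ?E (X r) \<omega> * exp l) / exp l"
      unfolding Yr by eventually_elim (simp add: field_simps)
  qed
  \<comment> \<open>The centring factors and the normalising constants, all
    \<open>F\<close>-measurable, so that \<open>W\<close> can be treated as a constant under
    conditioning.\<close>
  define W where "W \<omega> = (\<Prod>r\<in>S. exp (- l * ?E (X r) \<omega>) * exp l)" for \<omega>
  have W [measurable]: "W \<in> borel_measurable F"
    unfolding W_def by measurable
  have W' [measurable]: "W \<in> borel_measurable M"
    using W subalg by (rule measurable_from_subalg[rotated])
  have PY [measurable]: "(\<lambda>\<omega>. \<Prod>r\<in>S. Y r \<omega>) \<in> borel_measurable M"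
    by (intro borel_measurable_prod Ym)
  have W0: "W \<omega> \<ge> 0" for \<omega> by (auto simp: W_def intro!: prod_nonneg)
  have WPY: "integrable M (\<lambda>\<omega>. W \<omega> * (\<Prod>r\<in>S. Y r \<omega>))"
  proof (rule integrable_const_bound)
    show "AE \<omega> in M. norm (W \<omega> * (\<Prod>r\<in>S. Y r \<omega>)) \<le> (\<Prod>r\<in>S. exp l)"
      using bdE bdYS
    proof eventually_elim
      case (elim \<omega>)
      have "W \<omega> \<le> (\<Prod>r\<in>S. exp l)"
        unfolding W_def using elim l by (intro prod_mono) (auto simp: mult_le_cancel_right1)
      moreover have "0 \<le> (\<Prod>r\<in>S. Y r \<omega>)" "(\<Prod>r\<in>S. Y r \<omega>) \<le> 1"
        using elim by (auto intro!: prod_nonneg prod_le_1)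
      ultimately have "W \<omega> * (\<Prod>r\<in>S. Y r \<omega>) \<le> (\<Prod>r\<in>S. exp l) * 1"
        using W0 by (intro mult_mono) (auto intro: prod_nonneg)
      then show ?case using W0 \<open>0 \<le> (\<Prod>r\<in>S. Y r \<omega>)\<close> by (simp add: abs_mult)
    qed
  qed measurable
  have "(\<integral>\<^sup>+\<omega>. exp (l * (\<Sum>r\<in>S. X r \<omega> - ?E (X r) \<omega>)) \<partial>M) \<le>
      (\<integral>\<^sup>+\<omega>. W \<omega> * (\<Prod>r\<in>S. Y r \<omega>) \<partial>M)"
    using bdS
  proof (intro nn_integral_mono_AE, eventually_elim)
    case (elim \<omega>)
    have "exp (l * (\<Sum>r\<in>S. X r \<omega> - ?E (X r) \<omega>)) =
        (\<Prod>r\<in>S. exp (- l * ?E (X r) \<omega>) * exp (l * X r \<omega>))"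
      by (simp add: sum_distrib_left exp_sum S exp_add[symmetric] algebra_simps)
    also have "\<dots> \<le> (\<Prod>r\<in>S. exp (- l * ?E (X r) \<omega>) * (1 - X r \<omega> + X r \<omega> * exp l))"
      using elim exp_le_chord[OF l] by (intro prod_mono) auto
    also have "\<dots> = W \<omega> * (\<Prod>r\<in>S. Y r \<omega>)"
      by (simp add: W_def Y_def prod.distrib[symmetric])
    finally show ?case by (rule ennreal_leI)
  qed
  also have "\<dots> = ennreal (\<integral>\<omega>. W \<omega> * (\<Prod>r\<in>S. Y r \<omega>) \<partial>M)"
  proof (rule nn_integral_eq_integral[OF WPY])
    show "AE \<omega> in M. 0 \<le> W \<omega> * (\<Prod>r\<in>S. Y r \<omega>)"
      using bdYS by eventually_elim (auto intro!: mult_nonneg_nonneg W0 prod_nonneg)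
  qed
  \<comment> \<open>Pulling out the \<open>F\<close>-measurable weight replaces the product by its
    conditional expectation, which then factorises.\<close>
  also have "(\<integral>\<omega>. W \<omega> * (\<Prod>r\<in>S. Y r \<omega>) \<partial>M) = (\<integral>\<omega>. W \<omega> * ?E (\<lambda>\<omega>. \<Prod>r\<in>S. Y r \<omega>) \<omega> \<partial>M)"
    by (rule real_cond_exp_intg(2)[symmetric, OF WPY]) measurable
  also have "\<dots> \<le> (\<integral>\<omega>. exp (real (card S) * l\<^sup>2 / 8) \<partial>M)"
  proof (rule integral_mono_AE)
    show "integrable M (\<lambda>\<omega>. W \<omega> * ?E (\<lambda>\<omega>. \<Prod>r\<in>S. Y r \<omega>) \<omega>)"
      by (rule real_cond_exp_intg(1)[OF WPY]) measurable
    have "AE \<omega> in M. ?E (\<lambda>\<omega>. \<Prod>r\<in>S. Y r \<omega>) \<omega> = (\<Prod>r\<in>S. ?E (Y r) \<omega>)"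
      by (rule real_cond_exp_prod_cond_indep[OF ciY S bdY])
    then show "AE \<omega> in M. W \<omega> * ?E (\<lambda>\<omega>. \<Prod>r\<in>S. Y r \<omega>) \<omega> \<le> exp (real (card S) * l\<^sup>2 / 8)"
      using EY bdE
    proof eventually_elim
      case (elim \<omega>)
      have "W \<omega> * ?E (\<lambda>\<omega>. \<Prod>r\<in>S. Y r \<omega>) \<omega> =
          (\<Prod>r\<in>S. exp (- l * ?E (X r) \<omega>) * (1 - ?E (X r) \<omega> + ?E (X r) \<omega> * exp l))"
        using elim by (simp add: W_def prod.distrib[symmetric])
      also have "\<dots> \<le> (\<Prod>r\<in>S. exp (l\<^sup>2 / 8))"
        using elim Hoeffding_chord_bound[OF l]
        by (intro prod_mono) (auto intro!: mult_nonneg_nonneg add_nonneg_nonneg)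
      also have "\<dots> = exp (real (card S) * l\<^sup>2 / 8)"
        by (simp add: exp_of_nat_mult[symmetric])
      finally show ?case .
    qed
  qed auto
  finally show ?thesis by (simp add: prob_space ennreal_leI)
qed

lemma cond_Hoeffding_ge:
  assumes "prob_space M"
    and ci: "cond_indep_vars M F R X" and S: "S \<subseteq> R" "S \<noteq> {}" "finite S"
    and bd: "\<And>r. r \<in> S \<Longrightarrow> AE \<omega> in M. X r \<omega> \<in> {0..1}"
    and \<epsilon>: "\<epsilon> > 0"
  shows "measure M {\<omega> \<in> space M. (\<Sum>r\<in>S. X r \<omega> - real_cond_exp M F (X r) \<omega>) \<ge> real (card S) * \<epsilon>}
      \<le> exp (- 2 * real (card S) * \<epsilon>\<^sup>2)"
proof -
  interpret prob_space M by fact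
  let ?D = "\<lambda>\<omega>. \<Sum>r\<in>S. X r \<omega> - real_cond_exp M F (X r) \<omega>"
  have X [measurable]: "X r \<in> borel_measurable M" if "r \<in> S" for r
    using ci S that unfolding cond_indep_vars_def by auto
  have D [measurable]: "?D \<in> borel_measurable M"
    by measurable
  \<comment> \<open>Markov's inequality for exp(l D) with l = 4 eps, the minimiser of -l n eps + n
    l^2 / 8 for n = card S; the minimum is -2 n eps^2.\<close>
  have "ennreal (prob {\<omega> \<in> space M. ?D \<omega> \<ge> real (card S) * \<epsilon>}) \<le>
      ennreal (exp (- (4 * \<epsilon>) * (real (card S) * \<epsilon>))) *
      (\<integral>\<^sup>+\<omega>. ennreal (exp (4 * \<epsilon> * ?D \<omega>)) * indicator (space M) \<omega> \<partial>M)"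
    unfolding emeasure_eq_measure[symmetric] using \<epsilon>
    by (intro Chernoff_ineq_nn_integral_ge) auto
  also have "(\<integral>\<^sup>+\<omega>. ennreal (exp (4 * \<epsilon> * ?D \<omega>)) * indicator (space M) \<omega> \<partial>M) =
      (\<integral>\<^sup>+\<omega>. ennreal (exp (4 * \<epsilon> * ?D \<omega>)) \<partial>M)"
    by (intro nn_integral_cong) auto
  also have "\<dots> \<le> ennreal (exp (real (card S) * (4 * \<epsilon>)\<^sup>2 / 8))"
    by (rule cond_Hoeffding_mgf) (use assms in auto)
  also have "ennreal (exp (- (4 * \<epsilon>) * (real (card S) * \<epsilon>))) * \<dots> =
      ennreal (exp (- 2 * real (card S) * \<epsilon>\<^sup>2))"
    by (simp add: ennreal_mult[symmetric] exp_add[symmetric] power2_eq_square algebra_simps)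
  finally show ?thesis
    by (simp add: mult_left_mono)
qed

text \<open>The lower tail of \<open>X\<close> is the upper tail of the reflected variables 1 - X,
  which again lie in [0,1] and are conditionally independent. The reflected conditional means are
  known only almost everywhere, so the two-sided event is covered by the two tails up to a null
  set.\<close>

lemma cond_Hoeffding_abs_ge:
  assumes "prob_space M"
    and ci: "cond_indep_vars M F R X" and S: "S \<subseteq> R" "S \<noteq> {}" "finite S"
    and bd: "\<And>r. r \<in> S \<Longrightarrow> AE \<omega> in M. X r \<omega> \<in> {0..1}"
    and \<epsilon>: "\<epsilon> > 0"
  shows "measure M {\<omega> \<in> space M. \<bar>\<Sum>r\<in>S. X r \<omega> - real_cond_exp M F (X r) \<omega>\<bar> \<ge> real (card S) * \<epsilon>}
      \<le> 2 * exp (- 2 * real (card S) * \<epsilon>\<^sup>2)"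
proof -
  interpret prob_space M by fact
  let ?E = "real_cond_exp M F"
  let ?X' = "\<lambda>r \<omega>. 1 - X r \<omega>"
  have X [measurable]: "X r \<in> borel_measurable M" if "r \<in> S" for r
    using ci S that unfolding cond_indep_vars_def by auto
  have ci': "cond_indep_vars M F R ?X'"
    by (rule cond_indep_vars_compose[OF ci]) measurable
  have bd': "AE \<omega> in M. ?X' r \<omega> \<in> {0..1}" if "r \<in> S" for r
    using bd[OF that] by eventually_elim auto
  have E': "AE \<omega> in M. \<forall>r\<in>S. ?E (?X' r) \<omega> = 1 - ?E (X r) \<omega>"
  proof (rule AE_finite_allI[OF S(3)])
    fix r assume r: "r \<in> S"
    have "AE \<omega> in M. ?E (?X' r) \<omega> = ?E (\<lambda>_. 1) \<omega> - ?E (X r) \<omega>"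
      using r bd by (intro real_cond_exp_diff integrable_unit_interval X) auto
    moreover have "AE \<omega> in M. ?E (\<lambda>_. 1) \<omega> = 1"
      by (rule real_cond_exp_F_meas) auto
    ultimately show "AE \<omega> in M. ?E (?X' r) \<omega> = 1 - ?E (X r) \<omega>"
      by eventually_elim simp
  qed
  let ?U = "{\<omega> \<in> space M. (\<Sum>r\<in>S. X r \<omega> - ?E (X r) \<omega>) \<ge> real (card S) * \<epsilon>}"
  let ?L = "{\<omega> \<in> space M. (\<Sum>r\<in>S. ?X' r \<omega> - ?E (?X' r) \<omega>) \<ge> real (card S) * \<epsilon>}"
  have "prob {\<omega> \<in> space M. \<bar>\<Sum>r\<in>S. X r \<omega> - ?E (X r) \<omega>\<bar> \<ge> real (card S) * \<epsilon>} \<le> prob (?U \<union> ?L)"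
  proof (rule finite_measure_mono_AE)
    show "AE \<omega> in M. \<omega> \<in> {\<omega> \<in> space M. \<bar>\<Sum>r\<in>S. X r \<omega> - ?E (X r) \<omega>\<bar> \<ge> real (card S) * \<epsilon>} \<longrightarrow>
        \<omega> \<in> ?U \<union> ?L"
      using E'
    proof eventually_elim
      case (elim \<omega>)
      then have "(\<Sum>r\<in>S. ?X' r \<omega> - ?E (?X' r) \<omega>) = - (\<Sum>r\<in>S. X r \<omega> - ?E (X r) \<omega>)"
        unfolding sum_negf[symmetric] by (intro sum.cong) auto
      then show ?case by auto
    qed
    show "?U \<union> ?L \<in> events" by measurable
  qed
  also have "\<dots> \<le> prob ?U + prob ?L"
    by (rule measure_Un_le) measurable
  also have "\<dots> \<le> 2 * exp (- 2 * real (card S) * \<epsilon>\<^sup>2)"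
    using cond_Hoeffding_ge[OF assms(1) ci S bd \<epsilon>] cond_Hoeffding_ge[OF assms(1) ci' S bd' \<epsilon>]
    by simp
  finally show ?thesis .
qed

end

section \<open>Union bound over peers and sample sizes\<close>

theorem lemma2:
  fixes M :: "'a measure"
    and J :: "'p set"
    and K nmax :: nat
    and X T :: "'p \<Rightarrow> nat \<Rightarrow> 'a \<Rightarrow> real"
    and \<mu> :: "'p \<Rightarrow> real \<Rightarrow> real"
    and \<delta> :: real
  assumes "prob_space M"
    and "finite J" and "card J \<le> K"
    and times: "\<And>j r. j \<in> J \<Longrightarrow> r \<in> {1..nmax} \<Longrightarrow> T j r \<in> borel_measurable M"
    and mean_meas: "\<And>j r. j \<in> J \<Longrightarrow> r \<in> {1..nmax} \<Longrightarrow>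
          (\<lambda>\<omega>. \<mu> j (T j r \<omega>)) \<in> borel_measurable M"
    and cond_indep: "\<And>j. j \<in> J \<Longrightarrow>
          cond_indep_vars M (generated_algebra M {1..nmax} (T j)) {1..nmax} (X j)"
    and bounded: "\<And>j r. j \<in> J \<Longrightarrow> r \<in> {1..nmax} \<Longrightarrow> AE \<omega> in M. X j r \<omega> \<in> {0..1}"
    and cond_mean: "\<And>j r. j \<in> J \<Longrightarrow> r \<in> {1..nmax} \<Longrightarrow>
          AE \<omega> in M. real_cond_exp M (generated_algebra M {1..nmax} (T j)) (X j r) \<omega> = \<mu> j (T j r \<omega>)"
    and "0 < \<delta>" and "\<delta> < 1"
  shows "measure M {\<omega> \<in> space M. \<forall>j\<in>J. \<forall>n\<in>{1..nmax}.
           \<bar>mu_hat (X j) n \<omega> - mu_bar (\<mu> j) (T j) n \<omega>\<bar> \<le> conf_radius K nmax n \<delta>} \<ge> 1 - \<delta>"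
proof -
  interpret prob_space M by fact
  define D where "D j n \<omega> = mu_hat (X j) n \<omega> - mu_bar (\<mu> j) (T j) n \<omega>" for j n \<omega>
  define B where "B j n = {\<omega> \<in> space M. \<bar>D j n \<omega>\<bar> > conf_radius K nmax n \<delta>}" for j n
  let ?G = "{\<omega> \<in> space M. \<forall>j\<in>J. \<forall>n\<in>{1..nmax}. \<bar>D j n \<omega>\<bar> \<le> conf_radius K nmax n \<delta>}"
  have X: "X j r \<in> borel_measurable M" if "j \<in> J" "r \<in> {1..nmax}" for j r
    using cond_indep[OF that(1)] that(2) unfolding cond_indep_vars_def by auto
  have D [measurable]: "D j n \<in> borel_measurable M" if "j \<in> J" "n \<in> {1..nmax}" for j n
    unfolding D_def mu_hat_def mu_bar_def using that
    by (intro borel_measurable_diff borel_measurable_times borel_measurable_const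
        borel_measurable_sum X mean_meas) auto
  have B: "B j n \<in> events" if "j \<in> J" "n \<in> {1..nmax}" for j n
    unfolding B_def using D[OF that] by measurable
  have le: "prob (B j n) \<le> \<delta> / (real K * real nmax)" if j: "j \<in> J" and n: "n \<in> {1..nmax}" for j n
  proof -
    \<comment> \<open>All \<open>nmax\<close> times are conditioned on, whatever n is; the first n
      probes enter as the subset {1..n} of the conditionally independent family.\<close>
    let ?F = "generated_algebra M {1..nmax} (T j)"
    let ?E = "real_cond_exp M ?F"
    let ?\<epsilon> = "conf_radius K nmax n \<delta>"
    have "subalgebra M ?F"
      using times[OF j] by (rule subalgebra_generated_algebra)
    then interpret finite_measure_subalgebra M ?F
      by unfold_locales
    have "K > 0" "nmax > 0" "n > 0"
      using j n \<open>finite J\<close> \<open>card J \<le> K\<close> card_gt_0_iff[of J] by auto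
    then have "real K * real nmax \<ge> 1" 
      by (metis Suc_leI nat_0_less_mult_iff of_nat_1 of_nat_le_iff of_nat_mult One_nat_def)
    \<comment> \<open>The logarithm is thus positive, which makes the radius an admissible eps and
      lets squaring undo the root.\<close>
    then have gt1: "2 * real K * real nmax / \<delta> > 1"
      using \<open>0 < \<delta>\<close> \<open>\<delta> < 1\<close> by (simp add: field_simps)
    then have \<epsilon>: "?\<epsilon> > 0" and sq: "2 * real n * ?\<epsilon>\<^sup>2 = ln (2 * real K * real nmax / \<delta>)"
      using \<open>n > 0\<close> by (auto simp: conf_radius_def)
    have "AE \<omega> in M. \<forall>r\<in>{1..n}. ?E (X j r) \<omega> = \<mu> j (T j r \<omega>)"
      using n by (intro AE_finite_allI cond_mean[OF j]) auto
    \<comment> \<open>Multiplying by n turns the deviation of averages into one of centred sums, and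
      the strict failure event lies in the closed event of the tail bound up to a null set.\<close>
    then have "prob (B j n) \<le> prob {\<omega> \<in> space M. \<bar>\<Sum>r = 1..n. X j r \<omega> - ?E (X j r) \<omega>\<bar> \<ge> real (card {1..n}) * ?\<epsilon>}"
    proof (intro finite_measure_mono_AE, eventually_elim)
      case (elim \<omega>)
      then have "D j n \<omega> = (\<Sum>r = 1..n. X j r \<omega> - ?E (X j r) \<omega>) / real n"
        by (simp add: D_def mu_hat_def mu_bar_def sum_subtractf diff_divide_distrib)
      then have "\<bar>\<Sum>r = 1..n. X j r \<omega> - ?E (X j r) \<omega>\<bar> = real n * \<bar>D j n \<omega>\<bar>"
        using \<open>n > 0\<close> by (simp add: abs_divide)
      then show ?case
        by (auto simp: B_def intro!: mult_left_mono)
    next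
      have "X j r \<in> borel_measurable M" if "r \<in> {1..n}" for r
        using X[OF j] n that by auto
      then show "{\<omega> \<in> space M. \<bar>\<Sum>r = 1..n. X j r \<omega> - ?E (X j r) \<omega>\<bar> \<ge> real (card {1..n}) * ?\<epsilon>} \<in> events"
        by measurable
    qed
    also have "\<dots> \<le> 2 * exp (- 2 * real (card {1..n}) * ?\<epsilon>\<^sup>2)"
      by (rule cond_Hoeffding_abs_ge[OF prob_space_axioms cond_indep[OF j]])
         (use n \<epsilon> bounded[OF j] in auto)
    also have "\<dots> = 2 * exp (- ln (2 * real K * real nmax / \<delta>))"
      using sq by simp
    also have "\<dots> = \<delta> / (real K * real nmax)"
      using gt1 by (simp add: exp_minus field_simps)
    finally show ?thesis .
  qed
  have G: "?G = space M - (\<Union>(j, n)\<in>J \<times> {1..nmax}. B j n)"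
    by (force simp: B_def not_less)
  have UB: "(\<Union>(j, n)\<in>J \<times> {1..nmax}. B j n) \<in> events"
    using B \<open>finite J\<close> by (intro sets.finite_UN) auto
  have "prob (\<Union>(j, n)\<in>J \<times> {1..nmax}. B j n) \<le> (\<Sum>(j, n)\<in>J \<times> {1..nmax}. prob (B j n))"
    unfolding case_prod_unfold
    by (rule finite_measure_subadditive_finite) (use B \<open>finite J\<close> in auto)
  also have "\<dots> \<le> (\<Sum>(j, n)\<in>J \<times> {1..nmax}. \<delta> / (real K * real nmax))"
    using le by (intro sum_mono) auto
  also have "\<dots> = real (card J) * real nmax * (\<delta> / (real K * real nmax))"
    by (simp add: case_prod_unfold card_cartesian_product)
  also have "\<dots> \<le> real K * real nmax * (\<delta> / (real K * real nmax))"
    using \<open>card J \<le> K\<close> \<open>0 < \<delta>\<close> by (intro mult_right_mono) auto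
  \<comment> \<open>An inequality rather than an equality: if K or nmax is 0, division by zero
    yields 0 and the left side vanishes.\<close>
  also have "\<dots> \<le> \<delta>"
    using \<open>0 < \<delta>\<close> by simp
  finally have "prob ?G \<ge> 1 - \<delta>"
    unfolding G using prob_compl[OF UB] by simp
  then show ?thesis
    unfolding D_def .
qed

end
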